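(* Let $p$ be an odd prime with $p \equiv 1 \pmod 4$, let $k \geq 1$ be an integer, and let $t \in \mathbb{Z}_{p^k}$. If $t \neq 0$, write $t = p^{\alpha}\beta$ where $p \nmid \beta$ and $0 \le \alpha < k$. Then $$ N_{3}(t, p^k) = \begin{cases} p^{2k} + p^{2k-1} - p^{\lceil\frac{3k}{2}\rceil - 1} & \text{if } t = 0, \\ (p^{2k - 1} - p^{2k - \frac{\alpha + 3}{2}})(p+1) & \text{if } t\neq 0 \text{ and } \alpha \text{ is odd}, \\ p^{2k-1}(p + 1) & \text{if } t\neq 0,\ \alpha \text{ is even and } \left(\frac{\beta}{p}\right) = 1, \\ p^{2k-1}(p+1) - 2p^{2k - 1-\frac{\alpha}{2}} & \text{if } t\neq 0,\ \alpha \text{ is even and } \left(\frac{\beta}{p}\right) = -1. \end{cases} $$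
   Context: $\mathbb{Z}_n$ denotes the ring of integers modulo $n$. For $t \in \mathbb{Z}_n$, $N_3(t,n)$ is the number of ordered triples $(x_1,x_2,x_3) \in \mathbb{Z}_n^3$ with $x_1^2+x_2^2+x_3^2 \equiv t \pmod n$ (zero entries are allowed). In the factorization $t = p^{\alpha}\beta$ the element $t$ is represented by a nonzero integer in $\{1,\dots,p^k-1\}$. $\left(\frac{\cdot}{p}\right)$ is the Legendre symbol and $\lceil x\rceil$ is the ceiling of $x$. *)

theory Defs
  imports "HOL-Number_Theory.Number_Theory"
begin

text \<open>The elements of the ring of integers modulo \<open>n\<close> are represented by the integers
  \<open>0, \<dots>, n - 1\<close>, the carrier of \<^const>\<open>residue_ring\<close>.\<close>

definition N3 :: "int \<Rightarrow> int \<Rightarrow> nat" where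
  "N3 t n = card {(x1, x2, x3).
     x1 \<in> carrier (residue_ring n) \<and> x2 \<in> carrier (residue_ring n) \<and>
     x3 \<in> carrier (residue_ring n) \<and> [x1\<^sup>2 + x2\<^sup>2 + x3\<^sup>2 = t] (mod n)}"

end

theory Submission imports Defs begin

text \<open>Write \<open>N(t, n)\<close> for the number of solutions of \<open>x\<^sup>2 + y\<^sup>2 + z\<^sup>2 \<equiv> t\<close> modulo \<open>n\<close>, and call a
  triple primitive if \<open>p\<close> does not divide all three entries.

  Modulo \<open>p\<close> the condition \<open>p \<equiv> 1 (mod 4)\<close> supplies \<open>i\<close> with \<open>i\<^sup>2 \<equiv> -1\<close>, and the substitution
  \<open>u = x + i y\<close> turns \<open>x\<^sup>2 + y\<^sup>2\<close> into \<open>u\<^sup>2 - 2 i u y\<close>, which is linear in \<open>y\<close>.  For each of the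
  \<open>p - 1\<close> classes \<open>u \<noteq> 0\<close> and each \<open>z\<close> there is exactly one \<open>y\<close>; for \<open>u = 0\<close> the entry \<open>y\<close> is free and
  \<open>z\<close> is a square root of \<open>t\<close>.  Hence \<open>N(t, p) = p\<^sup>2 + p (t/p)\<close>, which is \<open>num_sols_prime\<close>.

  For \<open>n = p ^ k\<close> the primitive and the imprimitive solutions are counted separately.  The gradient
  \<open>2 (x, y, z)\<close> does not vanish modulo \<open>p\<close> at a primitive triple, so every primitive solution modulo
  \<open>p ^ k\<close> has exactly \<open>p\<^sup>2\<close> lifts modulo \<open>p ^ (k + 1)\<close> (\<open>num_prim_sols_lift\<close>).  An imprimitive
  solution is \<open>p\<close> times a triple; for \<open>k \<ge> 2\<close> it can exist only if \<open>p\<^sup>2\<close> divides \<open>t\<close>, and dividing the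
  congruence by \<open>p\<^sup>2\<close> leads to \<open>N(t / p\<^sup>2, p ^ (k - 2))\<close>.  Together these give the recurrence
  \<open>N(p\<^sup>2 t, p ^ (k + 2)) = p ^ (2 k + 2) (p\<^sup>2 - 1) + p\<^sup>3 N(t, p ^ k)\<close> (\<open>num_sols_descent\<close>).

  Each step lowers the valuation of \<open>t\<close> and the exponent \<open>k\<close> by two.  A nonzero \<open>t\<close> ends at
  valuation 0 or 1, where only primitive solutions remain; \<open>t = 0\<close> ends at \<open>k = 0\<close> or \<open>k = 1\<close>.
  Solving the recurrence from these initial values yields the four formulas.\<close>

section \<open>Counting triples of residues\<close>

lemma int_card_filter:
  assumes "finite A"
  shows "int (card {x \<in> A. P x}) = (\<Sum>x\<in>A. of_bool (P x))"
proof -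
  have "{x \<in> A. P x} = A \<inter> {x. P x}" by blast
  then show ?thesis using assms by (simp add: sum_of_bool_eq)
qed

text \<open>A nested sum of indicators, rather than the cardinality of a set of triples, so that the order
  of summation can be exchanged and each coordinate can be reindexed on its own.\<close>

definition count3 :: "int \<Rightarrow> (int \<Rightarrow> int \<Rightarrow> int \<Rightarrow> bool) \<Rightarrow> int" where
  "count3 n P = (\<Sum>x\<in>{0..<n}. \<Sum>y\<in>{0..<n}. \<Sum>z\<in>{0..<n}. of_bool (P x y z))"

definition num_sols :: "int \<Rightarrow> int \<Rightarrow> int" where
  "num_sols t n = count3 n (\<lambda>x y z. n dvd x\<^sup>2 + y\<^sup>2 + z\<^sup>2 - t)"

lemma N3_eq_num_sols:
  assumes "n > 0"
  shows "int (N3 t n) = num_sols t n"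
proof -
  let ?I = "{0..<n}" and ?P = "\<lambda>(x, y, z). n dvd x\<^sup>2 + y\<^sup>2 + z\<^sup>2 - t"
  have carrier: "carrier (residue_ring n) = ?I"
    by (auto simp: residue_ring_def)
  have "int (N3 t n) = int (card {v \<in> ?I \<times> ?I \<times> ?I. ?P v})"
    unfolding N3_def carrier cong_iff_dvd_diff by (rule arg_cong[of _ _ "\<lambda>A. int (card A)"]) auto
  also have "\<dots> = (\<Sum>v\<in>?I \<times> ?I \<times> ?I. of_bool (?P v))"
    by (intro int_card_filter) simp
  also have "\<dots> = num_sols t n"
    by (simp only: num_sols_def count3_def sum.cartesian_product case_prod_unfold)
  finally show ?thesis .
qed

lemma count3_False [simp]: "count3 n (\<lambda>x y z. False) = 0"
  by (simp add: count3_def)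

lemma count3_split:
  "count3 n P = count3 n (\<lambda>x y z. P x y z \<and> Q x y z) + count3 n (\<lambda>x y z. P x y z \<and> \<not> Q x y z)"
proof -
  have "(of_bool (A :: bool) :: int) = of_bool (A \<and> B) + of_bool (A \<and> \<not> B)" for A B
    by auto
  then show ?thesis
    unfolding count3_def sum.distrib[symmetric] by (intro sum.cong refl)
qed

text \<open>Division with remainder by \<open>m\<close> identifies the residues modulo \<open>m q\<close> with the pairs of a residue
  modulo \<open>m\<close> and a quotient below \<open>q\<close>.\<close>

lemma sum_mult_interval:
  fixes f :: "int \<Rightarrow> int"
  assumes "m > 0"
  shows "(\<Sum>x\<in>{0..<m * q}. f x) = (\<Sum>a\<in>{0..<m}. \<Sum>x\<in>{0..<q}. f (a + m * x))"
proof -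
  have "(\<Sum>x\<in>{0..<m * q}. f x) = (\<Sum>(a, x)\<in>{0..<m} \<times> {0..<q}. f (a + m * x))"
  proof (rule sum.reindex_bij_witness[where i = "\<lambda>(a, x). a + m * x" and j = "\<lambda>x. (x mod m, x div m)"])
    fix v assume "v \<in> {0..<m} \<times> {0..<q}"
    then obtain a x where v: "v = (a, x)" "0 \<le> a" "a < m" "0 \<le> x" "x < q" by auto
    then show "(case v of (a, x) \<Rightarrow> a + m * x) \<in> {0..<m * q}"
      using assms mult_left_mono[of "x + 1" q m] by (auto simp: algebra_simps)
    show "((case v of (a, x) \<Rightarrow> a + m * x) mod m, (case v of (a, x) \<Rightarrow> a + m * x) div m) = v"
      using v assms by simp
  next
    fix x assume x: "x \<in> {0..<m * q}"
    have "x div m < q"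
    proof (rule ccontr)
      assume "\<not> x div m < q"
      then have "m * q \<le> m * (x div m)" using assms by simp
      also have "\<dots> \<le> m * (x div m) + x mod m" using pos_mod_sign[OF assms, of x] by linarith
      also have "\<dots> = x" by simp
      finally show False using x by simp
    qed
    then show "(x mod m, x div m) \<in> {0..<m} \<times> {0..<q}"
      using x assms by (simp add: pos_imp_zdiv_nonneg_iff)
  qed auto
  then show ?thesis by (simp add: sum.cartesian_product)
qed

lemma sum_dvd_interval:
  fixes f :: "int \<Rightarrow> int"
  assumes "m > 0"
  shows "(\<Sum>x\<in>{0..<m * q}. of_bool (m dvd x) * f x) = (\<Sum>x\<in>{0..<q}. f (m * x))"
proof -
  have "(\<Sum>x\<in>{0..<m * q}. of_bool (m dvd x) * f x)
      = (\<Sum>a\<in>{0..<m}. \<Sum>x\<in>{0..<q}. of_bool (m dvd a) * f (a + m * x))"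
    unfolding sum_mult_interval[OF assms] by (simp only: dvd_add_left_iff dvd_triv_left)
  also have "\<dots> = (\<Sum>a\<in>{0}. \<Sum>x\<in>{0..<q}. of_bool (m dvd a) * f (a + m * x))"
    using assms by (intro sum.mono_neutral_right) (auto dest: zdvd_imp_le)
  finally show ?thesis by simp
qed

text \<open>Triples modulo \<open>m q\<close> are grouped by their reduction \<open>(a, b, c)\<close> modulo \<open>m\<close>; the inner count runs
  over the lifts of that reduction.\<close>

lemma count3_fibre:
  assumes "m > 0"
  shows "count3 (m * q) P = (\<Sum>a\<in>{0..<m}. \<Sum>b\<in>{0..<m}. \<Sum>c\<in>{0..<m}.
           count3 q (\<lambda>x y z. P (a + m * x) (b + m * y) (c + m * z)))"
proof -
  let ?M = "{0..<m}" and ?Q = "{0..<q}"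
  let ?F = "\<lambda>a x b y c z. of_bool (P (a + m * x) (b + m * y) (c + m * z)) :: int"
  have "count3 (m * q) P = (\<Sum>a\<in>?M. \<Sum>x\<in>?Q. \<Sum>b\<in>?M. \<Sum>y\<in>?Q. \<Sum>c\<in>?M. \<Sum>z\<in>?Q. ?F a x b y c z)"
    unfolding count3_def sum_mult_interval[OF assms] ..
  also have "\<dots> = (\<Sum>a\<in>?M. \<Sum>b\<in>?M. \<Sum>x\<in>?Q. \<Sum>y\<in>?Q. \<Sum>c\<in>?M. \<Sum>z\<in>?Q. ?F a x b y c z)"
    by (intro sum.cong refl sum.swap)
  also have "\<dots> = (\<Sum>a\<in>?M. \<Sum>b\<in>?M. \<Sum>x\<in>?Q. \<Sum>c\<in>?M. \<Sum>y\<in>?Q. \<Sum>z\<in>?Q. ?F a x b y c z)"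
    by (intro sum.cong refl sum.swap)
  also have "\<dots> = (\<Sum>a\<in>?M. \<Sum>b\<in>?M. \<Sum>c\<in>?M. \<Sum>x\<in>?Q. \<Sum>y\<in>?Q. \<Sum>z\<in>?Q. ?F a x b y c z)"
    by (intro sum.cong refl sum.swap)
  finally show ?thesis unfolding count3_def .
qed

lemma count3_periodic:
  assumes "m > 0" "q > 0" and "\<And>a b c x y z. P (a + m * x) (b + m * y) (c + m * z) \<longleftrightarrow> P a b c"
  shows "count3 (m * q) P = q ^ 3 * count3 m P"
proof -
  have "count3 q (\<lambda>x y z. B) = q ^ 3 * of_bool B" for B
    using assms(2) by (simp add: count3_def power3_eq_cube)
  then show ?thesis
    unfolding count3_fibre[OF assms(1)] assms(3)
    by (simp only: count3_def[of m] sum_distrib_left)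
qed

text \<open>This is what makes imprimitive solutions accessible: dividing all entries by \<open>m\<close> leaves
  unrestricted triples in a box whose side is shorter by the factor \<open>m\<close>.\<close>

lemma count3_all_dvd:
  assumes "m > 0"
  shows "count3 (m * q) (\<lambda>x y z. P x y z \<and> m dvd x \<and> m dvd y \<and> m dvd z)
       = count3 q (\<lambda>x y z. P (m * x) (m * y) (m * z))"
proof -
  have "count3 (m * q) (\<lambda>x y z. P x y z \<and> m dvd x \<and> m dvd y \<and> m dvd z)
      = (\<Sum>x\<in>{0..<m * q}. of_bool (m dvd x) * (\<Sum>y\<in>{0..<m * q}. of_bool (m dvd y) *
          (\<Sum>z\<in>{0..<m * q}. of_bool (m dvd z) * of_bool (P x y z))))"
    unfolding count3_def sum_distrib_left by (intro sum.cong refl) auto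
  then show ?thesis
    unfolding sum_dvd_interval[OF assms] count3_def .
qed

lemma sum_shift_periodic:
  fixes f :: "int \<Rightarrow> int"
  assumes "p > 0" and "\<And>x. f (x mod p) = f x"
  shows "(\<Sum>x\<in>{0..<p}. f x) = (\<Sum>u\<in>{0..<p}. f (u - d))"
proof (rule sum.reindex_bij_witness[where i = "\<lambda>u. (u - d) mod p" and j = "\<lambda>x. (x + d) mod p"])
  fix x assume "x \<in> {0..<p}"
  then show "((x + d) mod p - d) mod p = x" by (simp add: mod_simps)
  show "f ((x + d) mod p - d) = f x"
    using assms(2)[of "(x + d) mod p - d"] assms(2)[of x] by (simp add: mod_simps)
next
  fix u assume "u \<in> {0..<p}"
  then show "((u - d) mod p + d) mod p = u" by (simp add: mod_simps)
qed (use assms in auto)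

section \<open>Linear and quadratic congruences modulo a prime\<close>

lemma sum_linear_congruence:
  fixes p a c :: int
  assumes "prime p" "\<not> p dvd a"
  shows "(\<Sum>x\<in>{0..<p}. of_bool (p dvd c + a * x)) = (1 :: int)"
proof -
  have p: "p > 1" using assms(1) by (rule prime_gt_1_int)
  have cop: "coprime a p" using assms by (metis coprime_commute prime_imp_coprime)
  then obtain b where b: "[a * b = 1] (mod p)" using cong_solve_coprime_int by blast
  define x0 where "x0 = (- c * b) mod p"
  have "[c + a * x0 = c + a * (- c * b)] (mod p)"
    unfolding x0_def by (intro cong_add cong_mult cong_refl) simp
  also have "c + a * (- c * b) = c - c * (a * b)" by (simp add: algebra_simps)
  also have "[c - c * (a * b) = c - c * 1] (mod p)"
    using b by (intro cong_diff cong_mult cong_refl)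
  finally have x0: "p dvd c + a * x0" by (simp add: cong_0_iff)
  have uniq: "x = x0" if "x \<in> {0..<p}" "p dvd c + a * x" for x
  proof -
    have "p dvd (c + a * x) - (c + a * x0)" using that x0 by (intro dvd_diff)
    then have "p dvd a * (x - x0)" by (simp add: algebra_simps)
    then have "p dvd x - x0" using assms prime_dvd_mult_iff by blast
    then have "x mod p = x0 mod p" by (simp add: mod_eq_dvd_iff)
    then show "x = x0" using that p by (simp add: x0_def)
  qed
  have "(\<Sum>x\<in>{0..<p}. of_bool (p dvd c + a * x)) = (\<Sum>x\<in>{x0}. of_bool (p dvd c + a * x) :: int)"
    using p uniq by (intro sum.mono_neutral_right) (auto simp: x0_def)
  then show ?thesis using x0 by simp
qed

text \<open>If one coefficient is invertible, the other two variables may be chosen freely and then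
  determine the remaining one.  The three cases differ only in which summation is moved innermost.\<close>

lemma count3_linear_congruence:
  fixes p :: int
  assumes "prime p" "\<not> (p dvd a \<and> p dvd b \<and> p dvd c)"
  shows "count3 p (\<lambda>x y z. p dvd e + (a * x + b * y + c * z)) = p\<^sup>2"
proof -
  have p: "p > 1" using assms(1) by (rule prime_gt_1_int)
  let ?F = "\<lambda>x y z. of_bool (p dvd e + (a * x + b * y + c * z)) :: int"
  let ?I = "{0..<p}"
  consider "\<not> p dvd a" | "\<not> p dvd b" | "\<not> p dvd c" using assms(2) by blast
  then show ?thesis
  proof cases
    case 1
    have "(\<Sum>x\<in>?I. \<Sum>y\<in>?I. \<Sum>z\<in>?I. ?F x y z) = (\<Sum>y\<in>?I. \<Sum>x\<in>?I. \<Sum>z\<in>?I. ?F x y z)"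
      by (rule sum.swap)
    also have "\<dots> = (\<Sum>y\<in>?I. \<Sum>z\<in>?I. \<Sum>x\<in>?I. ?F x y z)"
      by (intro sum.cong refl sum.swap)
    also have "\<dots> = (\<Sum>y\<in>?I. \<Sum>z\<in>?I. 1)"
      using sum_linear_congruence[OF assms(1) 1, of "e + b * y + c * z" for y z]
      by (intro sum.cong refl) (simp add: algebra_simps)
    finally show ?thesis using p by (simp add: count3_def power2_eq_square)
  next
    case 2
    have "(\<Sum>x\<in>?I. \<Sum>y\<in>?I. \<Sum>z\<in>?I. ?F x y z) = (\<Sum>x\<in>?I. \<Sum>z\<in>?I. \<Sum>y\<in>?I. ?F x y z)"
      by (intro sum.cong refl sum.swap)
    also have "\<dots> = (\<Sum>x\<in>?I. \<Sum>z\<in>?I. 1)"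
      using sum_linear_congruence[OF assms(1) 2, of "e + a * x + c * z" for x z]
      by (intro sum.cong refl) (simp add: algebra_simps)
    finally show ?thesis using p by (simp add: count3_def power2_eq_square)
  next
    case 3
    have "(\<Sum>x\<in>?I. \<Sum>y\<in>?I. \<Sum>z\<in>?I. ?F x y z) = (\<Sum>x\<in>?I. \<Sum>y\<in>?I. 1)"
      using sum_linear_congruence[OF assms(1) 3, of "e + a * x + b * y" for x y]
      by (intro sum.cong refl) (simp add: algebra_simps)
    then show ?thesis using p by (simp add: count3_def power2_eq_square)
  qed
qed

lemma odd_prime_not_dvd_2:
  fixes p :: int
  assumes "prime p" "odd p"
  shows "\<not> p dvd 2"
proof
  assume "p dvd 2"
  then have "p \<le> 2" by (rule zdvd_imp_le) simp
  then show False using assms prime_gt_1_int[of p] by (cases "p = 2") auto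
qed

lemma sum_square_roots:
  fixes p t :: int
  assumes "prime p" "odd p"
  shows "(\<Sum>z\<in>{0..<p}. of_bool (p dvd z\<^sup>2 - t)) = 1 + Legendre t p"
proof -
  have p: "p > 1" using assms(1) by (rule prime_gt_1_int)
  let ?S = "{z \<in> {0..<p}. p dvd z\<^sup>2 - t}"
  have sum_card: "(\<Sum>z\<in>{0..<p}. of_bool (p dvd z\<^sup>2 - t)) = int (card ?S)"
    by (rule int_card_filter[symmetric]) simp
  have roots: "?S = {r, (- r) mod p}" if "r \<in> {0..<p}" "p dvd r\<^sup>2 - t" for r
  proof -
    have "p dvd z\<^sup>2 - t \<longleftrightarrow> z = r \<or> z = (- r) mod p" if z: "z \<in> {0..<p}" for z
    proof -
      have "p dvd z\<^sup>2 - t \<longleftrightarrow> p dvd (z\<^sup>2 - t) - (r\<^sup>2 - t)"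
        using \<open>p dvd r\<^sup>2 - t\<close> by (metis dvd_diff diff_add_cancel dvd_add)
      also have "(z\<^sup>2 - t) - (r\<^sup>2 - t) = (z - r) * (z - (- r))"
        by (simp add: algebra_simps power2_eq_square)
      also have "p dvd \<dots> \<longleftrightarrow> z mod p = r mod p \<or> z mod p = (- r) mod p"
        using assms(1) by (simp only: prime_dvd_mult_iff mod_eq_dvd_iff)
      finally show ?thesis using z \<open>r \<in> {0..<p}\<close> by simp
    qed
    then show ?thesis using \<open>r \<in> {0..<p}\<close> p by auto
  qed
  consider "p dvd t" | "\<not> p dvd t" "QuadRes p t" | "\<not> p dvd t" "\<not> QuadRes p t" by blast
  then show ?thesis
  proof cases
    case 1
    then have "?S = {0}" using roots[of 0] p by simp
    moreover have "Legendre t p = 0" using 1 by (simp add: Legendre_def cong_0_iff)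
    ultimately show ?thesis unfolding sum_card by simp
  next
    case 2
    then obtain y where y: "[y\<^sup>2 = t] (mod p)" unfolding QuadRes_def by blast
    define r where "r = y mod p"
    have r: "r \<in> {0..<p}" "p dvd r\<^sup>2 - t"
      using y p by (auto simp: r_def cong_def mod_eq_dvd_iff[symmetric] power_mod)
    have "\<not> p dvd r"
    proof
      assume "p dvd r"
      then have "p dvd r\<^sup>2" by (simp add: power2_eq_square)
      then have "p dvd r\<^sup>2 - (r\<^sup>2 - t)" using r(2) by (rule dvd_diff)
      then show False using 2(1) by simp
    qed
    moreover have "\<not> p dvd 2"
      using assms(1,2) by (rule odd_prime_not_dvd_2)
    ultimately have "\<not> p dvd 2 * r" using assms(1) by (simp add: prime_dvd_mult_iff)
    then have "r mod p \<noteq> (- r) mod p" by (simp add: mod_eq_dvd_iff)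
    then have "card ?S = 2" unfolding roots[OF r] using r(1) by simp
    moreover have "Legendre t p = 1" using 2 by (simp add: Legendre_def cong_0_iff)
    ultimately show ?thesis unfolding sum_card by simp
  next
    case 3
    then have "?S = {}" by (auto simp: QuadRes_def cong_iff_dvd_diff)
    moreover have "Legendre t p = -1" using 3 by (simp add: Legendre_def cong_0_iff)
    ultimately show ?thesis unfolding sum_card by (simp only: card.empty)
  qed
qed

text \<open>By Euler's criterion, since \<open>(p - 1) / 2\<close> is even.\<close>

lemma sqrt_minus_one:
  fixes p :: int
  assumes "prime p" "[p = 1] (mod 4)"
  obtains i where "p dvd i\<^sup>2 + 1"
proof -
  have p: "p > 1" using assms(1) by (rule prime_gt_1_int)
  have "p mod 4 = 1" using assms(2) by (simp add: cong_def)
  then have p2: "p > 2" using p by (cases "p = 2") auto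
  define q where "q = nat p"
  have q: "prime q" "2 < q" "int q = p"
    using prime_int_nat_transfer[of p] assms(1) p2 unfolding q_def by (blast, simp_all)
  have "int (q mod 4) = 1" using \<open>p mod 4 = 1\<close> q(3) by (simp add: zmod_int)
  then have "even ((q - 1) div 2)" by presburger
  then have "[Legendre (-1) p = 1] (mod p)"
    using euler_criterion[OF q(1,2), of "-1"] unfolding q(3) by simp
  then have "p dvd Legendre (-1) p - 1" by (simp add: cong_iff_dvd_diff)
  moreover have "\<not> p dvd - 1" "\<not> p dvd - 2" using p2 by (auto dest: zdvd_imp_le)
  ultimately have "QuadRes p (-1)" by (auto simp: Legendre_def split: if_splits)
  then obtain i where "[i\<^sup>2 = -1] (mod p)" unfolding QuadRes_def by blast
  then show ?thesis using that[of i] by (simp add: cong_iff_dvd_diff)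
qed

section \<open>Solutions modulo a prime\<close>

text \<open>The form \<open>x\<^sup>2 + y\<^sup>2\<close> is a hyperbolic plane when \<open>-1\<close> is a square.  Replacing only \<open>x\<close> by
  \<open>u = x + i y\<close> already makes the congruence linear in \<open>y\<close>, and for fixed \<open>y\<close> this replacement is a
  mere translation of residues.\<close>

lemma num_sols_prime:
  fixes p t :: int
  assumes "prime p" "odd p" "[p = 1] (mod 4)"
  shows "num_sols t p = p\<^sup>2 + p * Legendre t p"
proof -
  have p: "p > 1" using assms(1) by (rule prime_gt_1_int)
  obtain i where i: "p dvd i\<^sup>2 + 1" using sqrt_minus_one[OF assms(1,3)] .
  let ?I = "{0..<p}"
  have "\<not> p dvd i"
  proof
    assume "p dvd i"
    then have "p dvd (i\<^sup>2 + 1) - i\<^sup>2" using i by (intro dvd_diff) (auto simp: power2_eq_square)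
    then show False using p by simp
  qed
  moreover have not2: "\<not> p dvd 2"
    using assms(1,2) by (rule odd_prime_not_dvd_2)
  ultimately have not2iu: "\<not> p dvd - (2 * i * u)" if "\<not> p dvd u" for u
    using that assms(1) by (simp add: prime_dvd_mult_iff)
  have shift: "p dvd (u - i * y)\<^sup>2 + y\<^sup>2 + z\<^sup>2 - t \<longleftrightarrow> p dvd (u\<^sup>2 + z\<^sup>2 - t) + - (2 * i * u) * y"
    for u y z
  proof -
    have "(u - i * y)\<^sup>2 + y\<^sup>2 + z\<^sup>2 - t = ((u\<^sup>2 + z\<^sup>2 - t) + - (2 * i * u) * y) + (i\<^sup>2 + 1) * y\<^sup>2"
      by (simp add: algebra_simps power2_eq_square)
    then show ?thesis using i by (simp only: dvd_add_left_iff dvd_mult2)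
  qed
  \<comment> \<open>Reducing \<open>x\<close> modulo \<open>p\<close> changes nothing, so the translation may leave the interval.\<close>
  have per: "p dvd (x mod p)\<^sup>2 + y\<^sup>2 + z\<^sup>2 - t \<longleftrightarrow> p dvd x\<^sup>2 + y\<^sup>2 + z\<^sup>2 - t" for x y z
  proof -
    have "((x mod p)\<^sup>2 + y\<^sup>2 + z\<^sup>2 - t) mod p = (x\<^sup>2 + y\<^sup>2 + z\<^sup>2 - t) mod p"
      by (intro mod_diff_cong mod_add_cong) (simp_all add: power_mod)
    then show ?thesis by (simp only: dvd_eq_mod_eq_0)
  qed
  have "num_sols t p = (\<Sum>y\<in>?I. \<Sum>x\<in>?I. \<Sum>z\<in>?I. of_bool (p dvd x\<^sup>2 + y\<^sup>2 + z\<^sup>2 - t))"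
    unfolding num_sols_def count3_def by (rule sum.swap)
  also have "\<dots> = (\<Sum>y\<in>?I. \<Sum>u\<in>?I. \<Sum>z\<in>?I. of_bool (p dvd (u\<^sup>2 + z\<^sup>2 - t) + - (2 * i * u) * y))"
    unfolding shift[symmetric]
  proof (rule sum.cong[OF refl])
    fix y
    show "(\<Sum>x\<in>?I. \<Sum>z\<in>?I. of_bool (p dvd x\<^sup>2 + y\<^sup>2 + z\<^sup>2 - t))
        = (\<Sum>u\<in>?I. \<Sum>z\<in>?I. of_bool (p dvd (u - i * y)\<^sup>2 + y\<^sup>2 + z\<^sup>2 - t) :: int)"
      using p by (intro sum_shift_periodic) (simp, simp only: per)
  qed
  also have "\<dots> = (\<Sum>u\<in>?I. \<Sum>y\<in>?I. \<Sum>z\<in>?I. of_bool (p dvd (u\<^sup>2 + z\<^sup>2 - t) + - (2 * i * u) * y))"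
    by (rule sum.swap)
  also have "\<dots> = (\<Sum>u\<in>?I. \<Sum>z\<in>?I. \<Sum>y\<in>?I. of_bool (p dvd (u\<^sup>2 + z\<^sup>2 - t) + - (2 * i * u) * y))"
    by (intro sum.cong refl sum.swap)
  also have "\<dots> = (\<Sum>z\<in>?I. p * of_bool (p dvd z\<^sup>2 - t)) + (\<Sum>u\<in>?I - {0}. \<Sum>z\<in>?I. 1)"
  proof -
    \<comment> \<open>The coefficient \<open>- 2 i u\<close> of \<open>y\<close> is invertible unless \<open>u = 0\<close>, which is therefore split off.\<close>
    have split: "(\<Sum>u\<in>?I. g u) = g 0 + (\<Sum>u\<in>?I - {0}. g u)" for g :: "int \<Rightarrow> int"
      using p by (intro sum.remove) auto
    have "\<not> p dvd u" if "u \<in> ?I - {0}" for u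
      using that by (auto dest: zdvd_imp_le)
    then have "(\<Sum>u\<in>?I - {0}. \<Sum>z\<in>?I. \<Sum>y\<in>?I. of_bool (p dvd (u\<^sup>2 + z\<^sup>2 - t) + - (2 * i * u) * y))
        = (\<Sum>u\<in>?I - {0}. \<Sum>z\<in>?I. 1 :: int)"
      by (intro sum.cong refl sum_linear_congruence assms(1) not2iu)
    moreover have "(\<Sum>z\<in>?I. \<Sum>y\<in>?I. of_bool (p dvd (0\<^sup>2 + z\<^sup>2 - t) + - (2 * i * 0) * y))
        = (\<Sum>z\<in>?I. p * of_bool (p dvd z\<^sup>2 - t))"
      using p by (intro sum.cong refl) simp
    ultimately show ?thesis
      by (simp only: split[of "\<lambda>u. \<Sum>z\<in>?I. \<Sum>y\<in>?I. of_bool (p dvd (u\<^sup>2 + z\<^sup>2 - t) + - (2 * i * u) * y)"])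
  qed
  also have "\<dots> = p * (1 + Legendre t p) + (p - 1) * p"
    using p by (simp add: sum_square_roots[OF assms(1,2), symmetric] sum_distrib_left)
  finally show ?thesis by (simp add: algebra_simps power2_eq_square)
qed

section \<open>Primitive and imprimitive solutions modulo prime powers\<close>

definition num_prim_sols :: "int \<Rightarrow> int \<Rightarrow> int \<Rightarrow> int" where
  "num_prim_sols p t n =
     count3 n (\<lambda>x y z. n dvd x\<^sup>2 + y\<^sup>2 + z\<^sup>2 - t \<and> \<not> (p dvd x \<and> p dvd y \<and> p dvd z))"

text \<open>The second summand counts the imprimitive solutions, with the common factor \<open>p\<close> taken out of
  every entry.\<close>

lemma num_sols_split:
  fixes p t :: int
  assumes "p > 0"
  shows "num_sols t (p * q) = num_prim_sols p t (p * q)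
       + count3 q (\<lambda>x y z. p * q dvd p\<^sup>2 * (x\<^sup>2 + y\<^sup>2 + z\<^sup>2) - t)"
  using count3_split[of "p * q" "\<lambda>x y z. p * q dvd x\<^sup>2 + y\<^sup>2 + z\<^sup>2 - t"
      "\<lambda>x y z. p dvd x \<and> p dvd y \<and> p dvd z"]
  unfolding num_sols_def num_prim_sols_def count3_all_dvd[OF assms]
  by (simp add: power_mult_distrib distrib_left)

text \<open>Hensel lifting.  With \<open>m = p ^ k\<close>, moving \<open>(a, b, c)\<close> by \<open>m (x, y, z)\<close> changes the sum of squares
  by \<open>m (2 a x + 2 b y + 2 c z)\<close> up to a multiple of \<open>m\<^sup>2\<close>, and \<open>p m\<close> divides \<open>m\<^sup>2\<close> as \<open>k \<ge> 1\<close>.  After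
  division by \<open>m\<close> the lifting condition is a single linear congruence modulo \<open>p\<close> in \<open>(x, y, z)\<close>,
  which is not degenerate because \<open>(a, b, c)\<close> is primitive and \<open>p\<close> is odd.\<close>

lemma num_prim_sols_lift:
  fixes p t :: int
  assumes "prime p" "odd p" "k \<ge> 1"
  shows "num_prim_sols p t (p ^ Suc k) = p\<^sup>2 * num_prim_sols p t (p ^ k)"
proof -
  let ?m = "p ^ k"
  let ?P = "\<lambda>n x y z. n dvd x\<^sup>2 + y\<^sup>2 + z\<^sup>2 - t \<and> \<not> (p dvd x \<and> p dvd y \<and> p dvd z)"
  have p: "p > 1" using assms(1) by (rule prime_gt_1_int)
  have pm: "p dvd ?m" using assms(3) by (simp add: dvd_power)
  have not2: "\<not> p dvd 2"
    using assms(1,2) by (rule odd_prime_not_dvd_2)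
  have fibre: "count3 p (\<lambda>x y z. ?P (?m * p) (a + ?m * x) (b + ?m * y) (c + ?m * z)) = p\<^sup>2 * of_bool (?P ?m a b c)"
    for a b c
  proof (cases "?P ?m a b c")
    case True
    then obtain e where e: "a\<^sup>2 + b\<^sup>2 + c\<^sup>2 - t = ?m * e" by (auto elim: dvdE)
    have "?P (?m * p) (a + ?m * x) (b + ?m * y) (c + ?m * z)
        \<longleftrightarrow> p dvd e + ((2 * a) * x + (2 * b) * y + (2 * c) * z)" for x y z
    proof -
      have "(a + ?m * x)\<^sup>2 + (b + ?m * y)\<^sup>2 + (c + ?m * z)\<^sup>2 - t
          = (a\<^sup>2 + b\<^sup>2 + c\<^sup>2 - t) + ?m * ((2 * a) * x + (2 * b) * y + (2 * c) * z)
            + ?m * (?m * (x\<^sup>2 + y\<^sup>2 + z\<^sup>2))"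
        by (simp add: algebra_simps power2_eq_square)
      also have "\<dots> = ?m * ((e + ((2 * a) * x + (2 * b) * y + (2 * c) * z)) + ?m * (x\<^sup>2 + y\<^sup>2 + z\<^sup>2))"
        unfolding e by (simp add: algebra_simps)
      finally have "?m * p dvd (a + ?m * x)\<^sup>2 + (b + ?m * y)\<^sup>2 + (c + ?m * z)\<^sup>2 - t
          \<longleftrightarrow> p dvd (e + ((2 * a) * x + (2 * b) * y + (2 * c) * z)) + ?m * (x\<^sup>2 + y\<^sup>2 + z\<^sup>2)"
        using p by simp
      also have "\<dots> \<longleftrightarrow> p dvd e + ((2 * a) * x + (2 * b) * y + (2 * c) * z)"
        using pm by (simp only: dvd_add_left_iff dvd_mult2)
      finally show ?thesis
        using True pm by (simp only: dvd_add_left_iff dvd_mult2) blast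
    qed
    moreover have "\<not> (p dvd 2 * a \<and> p dvd 2 * b \<and> p dvd 2 * c)"
      using True not2 assms(1) by (simp add: prime_dvd_mult_iff)
    ultimately show ?thesis
      using True count3_linear_congruence[OF assms(1), of "2 * a" "2 * b" "2 * c" e] by simp
  next
    case False
    have "\<not> ?P (?m * p) (a + ?m * x) (b + ?m * y) (c + ?m * z)" for x y z
    proof
      assume *: "?P (?m * p) (a + ?m * x) (b + ?m * y) (c + ?m * z)"
      have "(a + ?m * x)\<^sup>2 + (b + ?m * y)\<^sup>2 + (c + ?m * z)\<^sup>2 - t
          = (a\<^sup>2 + b\<^sup>2 + c\<^sup>2 - t)
            + ?m * (2 * a * x + 2 * b * y + 2 * c * z + ?m * (x\<^sup>2 + y\<^sup>2 + z\<^sup>2))"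
        by (simp add: algebra_simps power2_eq_square)
      moreover have "?m dvd (a + ?m * x)\<^sup>2 + (b + ?m * y)\<^sup>2 + (c + ?m * z)\<^sup>2 - t"
        using * dvd_mult_left by blast
      ultimately have "?m dvd a\<^sup>2 + b\<^sup>2 + c\<^sup>2 - t"
        by (simp only: dvd_add_left_iff dvd_triv_left)
      moreover have "\<not> (p dvd a \<and> p dvd b \<and> p dvd c)"
        using * pm by (simp only: dvd_add_left_iff dvd_mult2) blast
      ultimately show False using False by blast
    qed
    then show ?thesis using False by (simp only: count3_False) simp
  qed
  have "num_prim_sols p t (?m * p) = (\<Sum>a\<in>{0..<?m}. \<Sum>b\<in>{0..<?m}. \<Sum>c\<in>{0..<?m}. p\<^sup>2 * of_bool (?P ?m a b c))"
    unfolding num_prim_sols_def fibre[symmetric] using p by (intro count3_fibre) simp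
  also have "\<dots> = p\<^sup>2 * count3 ?m (?P ?m)"
    by (simp only: count3_def sum_distrib_left)
  finally show ?thesis by (simp add: num_prim_sols_def mult.commute)
qed

lemma num_prim_sols_prime_power:
  fixes p t :: int
  assumes "prime p" "odd p"
  shows "num_prim_sols p t (p ^ Suc k) = p ^ (2 * k) * num_prim_sols p t p"
proof (induction k)
  case (Suc k)
  then show ?case
    using num_prim_sols_lift[OF assms, of "Suc k" t] by (simp add: power2_eq_square)
qed simp

text \<open>The only imprimitive triple modulo \<open>p\<close> is zero, and it is a solution exactly if \<open>p\<close> divides \<open>t\<close>.\<close>

lemma num_prim_sols_prime:
  fixes p t :: int
  assumes "prime p" "odd p" "[p = 1] (mod 4)"
  shows "num_prim_sols p t p = p\<^sup>2 + p * Legendre t p - of_bool (p dvd t)"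
proof -
  have p: "p > 1" using assms(1) by (rule prime_gt_1_int)
  have "count3 1 (\<lambda>x y z. p dvd p\<^sup>2 * (x\<^sup>2 + y\<^sup>2 + z\<^sup>2) - t) = of_bool (p dvd t)"
    unfolding count3_def by (simp add: atLeastLessThanPlusOne_atLeastAtMost_int[of 0 0, simplified])
  then show ?thesis
    using num_sols_split[where p = p and t = t and q = 1] num_sols_prime[OF assms, of t] p by simp
qed

text \<open>An imprimitive triple has a sum of squares divisible by \<open>p\<close>, so all solutions are primitive.\<close>

lemma num_sols_unit:
  fixes p t :: int
  assumes "prime p" "odd p" "[p = 1] (mod 4)" "\<not> p dvd t"
  shows "num_sols t (p ^ Suc k) = p ^ (2 * k) * (p\<^sup>2 + p * Legendre t p)"
proof -
  have p: "p > 1" using assms(1) by (rule prime_gt_1_int)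
  have "\<not> p * p ^ k dvd p\<^sup>2 * s - t" for s
  proof
    assume "p * p ^ k dvd p\<^sup>2 * s - t"
    then have "p dvd p\<^sup>2 * s - t" by (rule dvd_mult_left)
    moreover have "p dvd p\<^sup>2 * s" by (simp add: power2_eq_square)
    ultimately have "p dvd p\<^sup>2 * s - (p\<^sup>2 * s - t)" by (rule dvd_diff[rotated])
    then show False using assms(4) by simp
  qed
  then have "num_sols t (p ^ Suc k) = num_prim_sols p t (p ^ Suc k)"
    using num_sols_split[where p = p and t = t and q = "p ^ k"] p by simp
  then show ?thesis
    unfolding num_prim_sols_prime_power[OF assms(1,2)] num_prim_sols_prime[OF assms(1-3)]
    using assms(4) by simp
qed

text \<open>An imprimitive triple has a sum of squares divisible by \<open>p\<^sup>2\<close>.  As the modulus is also divisible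
  by \<open>p\<^sup>2\<close>, all solutions are primitive.\<close>

lemma num_sols_dvd_once:
  fixes p t :: int
  assumes "prime p" "odd p" "[p = 1] (mod 4)" "p dvd t" "\<not> p\<^sup>2 dvd t"
  shows "num_sols t (p ^ (k + 2)) = p ^ (2 * k + 2) * (p\<^sup>2 - 1)"
proof -
  have p: "p > 1" using assms(1) by (rule prime_gt_1_int)
  have "\<not> p * p ^ Suc k dvd p\<^sup>2 * s - t" for s
  proof
    assume "p * p ^ Suc k dvd p\<^sup>2 * s - t"
    moreover have "p\<^sup>2 dvd p * p ^ Suc k" by (simp add: power2_eq_square)
    ultimately have "p\<^sup>2 dvd p\<^sup>2 * s - t" by (rule dvd_trans[rotated])
    then have "p\<^sup>2 dvd p\<^sup>2 * s - (p\<^sup>2 * s - t)" by (rule dvd_diff[OF dvd_triv_left])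
    then show False using assms(5) by simp
  qed
  then have "num_sols t (p ^ Suc (Suc k)) = num_prim_sols p t (p ^ Suc (Suc k))"
    using num_sols_split[where p = p and t = t and q = "p ^ Suc k"] p by simp
  moreover have "Legendre t p = 0" using assms(4) by (simp add: Legendre_def cong_0_iff)
  ultimately show ?thesis
    using assms(4) unfolding num_prim_sols_prime_power[OF assms(1,2)] num_prim_sols_prime[OF assms(1-3)]
    by simp
qed

text \<open>The first summand counts the primitive solutions.  An imprimitive one is \<open>p (x, y, z)\<close> with
  entries \<open>x, y, z\<close> modulo \<open>p ^ (k + 1)\<close>, but after division by \<open>p\<^sup>2\<close> the congruence only sees them
  modulo \<open>p ^ k\<close>; this redundancy is the factor \<open>p\<^sup>3\<close>.\<close>

lemma num_sols_descent:
  fixes p t :: int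
  assumes "prime p" "odd p" "[p = 1] (mod 4)"
  shows "num_sols (p\<^sup>2 * t) (p ^ (k + 2)) = p ^ (2 * k + 2) * (p\<^sup>2 - 1) + p ^ 3 * num_sols t (p ^ k)"
proof -
  have p: "p > 1" using assms(1) by (rule prime_gt_1_int)
  have "p * (p ^ k * p) dvd p\<^sup>2 * (x\<^sup>2 + y\<^sup>2 + z\<^sup>2) - p\<^sup>2 * t \<longleftrightarrow> p ^ k dvd x\<^sup>2 + y\<^sup>2 + z\<^sup>2 - t" for x y z
  proof -
    have "p * (p ^ k * p) = p\<^sup>2 * p ^ k" by (simp add: power2_eq_square)
    moreover have "p\<^sup>2 * (x\<^sup>2 + y\<^sup>2 + z\<^sup>2) - p\<^sup>2 * t = p\<^sup>2 * (x\<^sup>2 + y\<^sup>2 + z\<^sup>2 - t)"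
      by (simp add: algebra_simps)
    ultimately show ?thesis using p by (simp only: dvd_mult_cancel_left) simp
  qed
  then have "num_sols (p\<^sup>2 * t) (p * (p ^ k * p)) = num_prim_sols p (p\<^sup>2 * t) (p * (p ^ k * p))
      + count3 (p ^ k * p) (\<lambda>x y z. p ^ k dvd x\<^sup>2 + y\<^sup>2 + z\<^sup>2 - t)"
    using num_sols_split[where p = p and t = "p\<^sup>2 * t" and q = "p ^ k * p"] p by simp
  moreover have "count3 (p ^ k * p) (\<lambda>x y z. p ^ k dvd x\<^sup>2 + y\<^sup>2 + z\<^sup>2 - t) = p ^ 3 * num_sols t (p ^ k)"
    unfolding num_sols_def
  proof (rule count3_periodic)
    fix a b c x y z
    have "(a + p ^ k * x)\<^sup>2 + (b + p ^ k * y)\<^sup>2 + (c + p ^ k * z)\<^sup>2 - t = (a\<^sup>2 + b\<^sup>2 + c\<^sup>2 - t)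
        + p ^ k * (2 * a * x + 2 * b * y + 2 * c * z + p ^ k * (x\<^sup>2 + y\<^sup>2 + z\<^sup>2))"
      by (simp add: algebra_simps power2_eq_square)
    then show "p ^ k dvd (a + p ^ k * x)\<^sup>2 + (b + p ^ k * y)\<^sup>2 + (c + p ^ k * z)\<^sup>2 - t
        \<longleftrightarrow> p ^ k dvd a\<^sup>2 + b\<^sup>2 + c\<^sup>2 - t"
      by (simp only: dvd_add_left_iff dvd_triv_left)
  qed (use p in auto)
  moreover have "p * (p ^ k * p) = p ^ Suc (Suc k)" by simp
  moreover have "num_prim_sols p (p\<^sup>2 * t) (p ^ Suc (Suc k)) = p ^ (2 * k + 2) * (p\<^sup>2 - 1)"
  proof -
    have "p dvd p\<^sup>2 * t" by (simp add: power2_eq_square)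
    moreover from this have "Legendre (p\<^sup>2 * t) p = 0" by (simp add: Legendre_def cong_0_iff)
    ultimately show ?thesis
      unfolding num_prim_sols_prime_power[OF assms(1,2)] num_prim_sols_prime[OF assms] by simp
  qed
  ultimately show ?thesis by simp
qed

section \<open>Solving the recurrence\<close>

text \<open>Multiplying by \<open>p\<close> avoids the exponents \<open>4 m - 1\<close> and \<open>3 m - 1\<close>, which would be truncated at the
  initial value \<open>m = 0\<close> of the induction.\<close>

lemma num_sols_0_even:
  fixes p :: int
  assumes "prime p" "odd p" "[p = 1] (mod 4)"
  shows "p * num_sols 0 (p ^ (2 * m)) = p ^ (4 * m + 1) + p ^ (4 * m) - p ^ (3 * m)"
proof (induction m)
  case 0
  show ?case by (simp add: num_sols_def count3_def atLeastLessThanPlusOne_atLeastAtMost_int[of 0 0, simplified])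
next
  case (Suc m)
  have "p * num_sols 0 (p ^ (2 * Suc m))
      = p * (p ^ (4 * m + 2) * (p\<^sup>2 - 1)) + p ^ 3 * (p * num_sols 0 (p ^ (2 * m)))"
    using num_sols_descent[OF assms, where t = 0 and k = "2 * m"] by (simp add: distrib_left)
  then show ?case unfolding Suc.IH by (simp add: algebra_simps power_add eval_nat_numeral)
qed

lemma num_sols_0_odd:
  fixes p :: int
  assumes "prime p" "odd p" "[p = 1] (mod 4)"
  shows "num_sols 0 (p ^ (2 * m + 1)) = p ^ (4 * m + 2) + p ^ (4 * m + 1) - p ^ (3 * m + 1)"
proof (induction m)
  case 0
  have "Legendre 0 p = 0" by (simp add: Legendre_def)
  then show ?case using num_sols_prime[OF assms, of 0] by (simp add: power2_eq_square)
next
  case (Suc m)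
  have "num_sols 0 (p ^ (2 * Suc m + 1))
      = p ^ (4 * m + 4) * (p\<^sup>2 - 1) + p ^ 3 * num_sols 0 (p ^ (2 * m + 1))"
  proof -
    have "2 * Suc m + 1 = (2 * m + 1) + 2" "2 * (2 * m + 1) + 2 = 4 * m + 4" by simp_all
    then show ?thesis
      using num_sols_descent[OF assms, where t = 0 and k = "2 * m + 1"] by (simp only: mult_zero_right)
  qed
  then show ?case unfolding Suc.IH by (simp add: algebra_simps power_add eval_nat_numeral)
qed

text \<open>The modulus has exponent \<open>k = 2 j + s + 1\<close>; parametrizing \<open>k > 2 j\<close> in this way keeps natural
  subtraction out of the exponents.  The case \<open>j = 0\<close> is the count for a unit, and the recurrence
  multiplies the deviation from \<open>p ^ (2 k - 1) (p + 1)\<close> by \<open>p\<^sup>3\<close> in each step.\<close>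

lemma num_sols_even_valuation:
  fixes p \<beta> :: int
  assumes "prime p" "odd p" "[p = 1] (mod 4)" "\<not> p dvd \<beta>"
  shows "num_sols (p ^ (2 * j) * \<beta>) (p ^ (2 * j + s + 1))
       = p ^ (4 * j + 2 * s + 1) * (p + 1) - (1 - Legendre \<beta> p) * p ^ (3 * j + 2 * s + 1)"
proof (induction j)
  case 0
  show ?case using num_sols_unit[OF assms, of s] by (simp add: algebra_simps power2_eq_square)
next
  case (Suc j)
  have "num_sols (p ^ (2 * Suc j) * \<beta>) (p ^ (2 * Suc j + s + 1))
      = p ^ (4 * j + 2 * s + 4) * (p\<^sup>2 - 1) + p ^ 3 * num_sols (p ^ (2 * j) * \<beta>) (p ^ (2 * j + s + 1))"
  proof -
    have "2 * Suc j + s + 1 = (2 * j + s + 1) + 2" "2 * (2 * j + s + 1) + 2 = 4 * j + 2 * s + 4" by simp_all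
    moreover have "p ^ (2 * Suc j) * \<beta> = p\<^sup>2 * (p ^ (2 * j) * \<beta>)" by (simp add: power2_eq_square)
    ultimately show ?thesis
      using num_sols_descent[OF assms(1-3), where t = "p ^ (2 * j) * \<beta>" and k = "2 * j + s + 1"] by (simp only:)
  qed
  then show ?case unfolding Suc.IH by (simp add: algebra_simps power_add eval_nat_numeral)
qed

text \<open>Here \<open>k = 2 j + s + 2\<close>, and the induction starts at valuation 1.\<close>

lemma num_sols_odd_valuation:
  fixes p \<beta> :: int
  assumes "prime p" "odd p" "[p = 1] (mod 4)" "\<not> p dvd \<beta>"
  shows "num_sols (p ^ (2 * j + 1) * \<beta>) (p ^ (2 * j + s + 2))
       = (p ^ (4 * j + 2 * s + 3) - p ^ (3 * j + 2 * s + 2)) * (p + 1)"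
proof (induction j)
  case 0
  have "\<not> p\<^sup>2 dvd p * \<beta>"
    using assms(1,4) by (auto simp: power2_eq_square)
  then show ?case using num_sols_dvd_once[OF assms(1-3), of "p * \<beta>" s]
    by (simp add: algebra_simps power2_eq_square eval_nat_numeral)
next
  case (Suc j)
  have "num_sols (p ^ (2 * Suc j + 1) * \<beta>) (p ^ (2 * Suc j + s + 2))
      = p ^ (4 * j + 2 * s + 6) * (p\<^sup>2 - 1) + p ^ 3 * num_sols (p ^ (2 * j + 1) * \<beta>) (p ^ (2 * j + s + 2))"
  proof -
    have "2 * Suc j + s + 2 = (2 * j + s + 2) + 2" "2 * (2 * j + s + 2) + 2 = 4 * j + 2 * s + 6" by simp_all
    moreover have "p ^ (2 * Suc j + 1) * \<beta> = p\<^sup>2 * (p ^ (2 * j + 1) * \<beta>)" by (simp add: power2_eq_square)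
    ultimately show ?thesis
      using num_sols_descent[OF assms(1-3), where t = "p ^ (2 * j + 1) * \<beta>" and k = "2 * j + s + 2"] by (simp only:)
  qed
  then show ?case unfolding Suc.IH by (simp add: algebra_simps power_add eval_nat_numeral)
qed

theorem theorem1p11:
  fixes p t \<beta> :: int and k \<alpha> :: nat
  assumes "prime p" and "odd p" and "[p = 1] (mod 4)" and "k \<ge> 1"
    and "t \<in> carrier (residue_ring (p ^ k))"
    and "t \<noteq> 0 \<Longrightarrow> t = p ^ \<alpha> * \<beta> \<and> \<not> p dvd \<beta> \<and> \<alpha> < k"
  shows "(t = 0 \<longrightarrow>
            int (N3 t (p ^ k)) =
              p ^ (2 * k) + p ^ (2 * k - 1) - p ^ (nat \<lceil>3 * real k / 2\<rceil> - 1)) \<and>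
         (t \<noteq> 0 \<and> odd \<alpha> \<longrightarrow>
            int (N3 t (p ^ k)) =
              (p ^ (2 * k - 1) - p ^ (2 * k - (\<alpha> + 3) div 2)) * (p + 1)) \<and>
         (t \<noteq> 0 \<and> even \<alpha> \<and> Legendre \<beta> p = 1 \<longrightarrow>
            int (N3 t (p ^ k)) = p ^ (2 * k - 1) * (p + 1)) \<and>
         (t \<noteq> 0 \<and> even \<alpha> \<and> Legendre \<beta> p = -1 \<longrightarrow>
            int (N3 t (p ^ k)) =
              p ^ (2 * k - 1) * (p + 1) - 2 * p ^ (2 * k - 1 - \<alpha> div 2))"
proof -
  note p_hyps = assms(1-3)
  have p: "p > 1" using assms(1) by (rule prime_gt_1_int)
  then have N3: "int (N3 t (p ^ k)) = num_sols t (p ^ k)" by (intro N3_eq_num_sols) simp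
  have zero: "int (N3 t (p ^ k)) = p ^ (2 * k) + p ^ (2 * k - 1) - p ^ (nat \<lceil>3 * real k / 2\<rceil> - 1)"
    if "t = 0"
  proof (cases "even k")
    case True
    then obtain m where k: "k = 2 * m" by (rule evenE)
    then obtain m' where m': "m = Suc m'" using assms(4) by (cases m) auto
    have "\<lceil>3 * real k / 2\<rceil> = int (3 * m)" using k by (intro ceiling_unique) simp_all
    moreover have "p * (p ^ (2 * k) + p ^ (2 * k - 1) - p ^ (3 * m - 1)) = p * num_sols 0 (p ^ k)"
      unfolding k num_sols_0_even[OF p_hyps] m' by (simp add: algebra_simps eval_nat_numeral)
    \<comment> \<open>The factor \<open>p\<close> can be cancelled now that \<open>m > 0\<close>.\<close>
    ultimately have "num_sols 0 (p ^ k) = p ^ (2 * k) + p ^ (2 * k - 1) - p ^ (nat \<lceil>3 * real k / 2\<rceil> - 1)"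
      using p by (simp only: nat_int mult_cancel_left) simp
    then show ?thesis using N3 that by simp
  next
    case False
    then obtain m where k: "k = 2 * m + 1" by (rule oddE)
    have "\<lceil>3 * real k / 2\<rceil> = int (3 * m + 2)"
      using k by (intro ceiling_unique) (simp_all add: field_simps)
    then have "nat \<lceil>3 * real k / 2\<rceil> - 1 = 3 * m + 1" by (simp only: nat_int)
    then show ?thesis
      using N3 num_sols_0_odd[OF p_hyps, of m] that k by simp
  qed
  have even_val: "int (N3 t (p ^ k))
      = p ^ (2 * k - 1) * (p + 1) - (1 - Legendre \<beta> p) * p ^ (2 * k - 1 - \<alpha> div 2)"
    if "t \<noteq> 0" "even \<alpha>"
  proof -
    have t: "t = p ^ \<alpha> * \<beta>" "\<not> p dvd \<beta>" "\<alpha> < k" using assms(6) that(1) by blast+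
    obtain j where j: "\<alpha> = 2 * j" using \<open>even \<alpha>\<close> by (rule evenE)
    obtain s where s: "k = 2 * j + s + 1" using t(3) j less_iff_Suc_add by auto
    have "2 * k - 1 = 4 * j + 2 * s + 1" "2 * k - 1 - \<alpha> div 2 = 3 * j + 2 * s + 1"
      using j s by simp_all
    moreover have "num_sols t (p ^ k) = p ^ (4 * j + 2 * s + 1) * (p + 1) - (1 - Legendre \<beta> p) * p ^ (3 * j + 2 * s + 1)"
      unfolding t(1) j s by (rule num_sols_even_valuation[OF p_hyps t(2)])
    ultimately show ?thesis by (simp only: N3)
  qed
  have odd_val: "int (N3 t (p ^ k)) = (p ^ (2 * k - 1) - p ^ (2 * k - (\<alpha> + 3) div 2)) * (p + 1)"
    if "t \<noteq> 0" "odd \<alpha>"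
  proof -
    have t: "t = p ^ \<alpha> * \<beta>" "\<not> p dvd \<beta>" "\<alpha> < k" using assms(6) that(1) by blast+
    obtain j where j: "\<alpha> = 2 * j + 1" using \<open>odd \<alpha>\<close> by (rule oddE)
    obtain s where s: "k = 2 * j + s + 2" using t(3) j less_iff_Suc_add by auto
    have "2 * k - 1 = 4 * j + 2 * s + 3" "2 * k - (\<alpha> + 3) div 2 = 3 * j + 2 * s + 2"
      using j s by simp_all
    moreover have "num_sols t (p ^ k) = (p ^ (4 * j + 2 * s + 3) - p ^ (3 * j + 2 * s + 2)) * (p + 1)"
      unfolding t(1) j s by (rule num_sols_odd_valuation[OF p_hyps t(2)])
    ultimately show ?thesis by (simp only: N3)
  qed
  show ?thesis using zero even_val odd_val by auto
qed

end
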